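(* Let $T\ge 2$ be an integer and $D>0$. Assume: (1) $F:[1,T]\times\mathbb{R}\times\mathbb{R}\times\mathbb{R}\to\mathbb{R}$, $(k,x,y,u)\mapsto F(k,x,y,u)$, is continuous and differentiable with respect to its second and third variables, and the partial derivatives $F_x,F_y:[1,T]\times\mathbb{R}\times\mathbb{R}\times\mathbb{R}\to\mathbb{R}$ are continuous. (2) For every fixed $y\in H$ there are a constant $\beta_1\in\mathbb{R}$, a function $\gamma_1:[1,T]\to\mathbb{R}$ and a constant $\alpha_1<1/(2c_2)$ such that $F(k,x,y(k),u)\ge-\alpha_1|x|^2+\beta_1x+\gamma_1(k)$ for all $x\in\mathbb{R}$, all $u\in\mathbb{R}$ with $|u|\le D$ and all $k\in[1,T]$. (3) For every fixed $x\in H$ there are a constant $\beta_2\in\mathbb{R}$, a function $\gamma_2:[1,T]\to\mathbb{R}$ and a constant $\alpha_2<1/(2c_2)$ such that $F(k,x(k),y,u)\le\alpha_2|y|^2+\beta_2y+\gamma_2(k)$ for all $y\in\mathbb{R}$, all $u\in\mathbb{R}$ with $|u|\le D$ and all $k\in[1,T]$. (4) For all $y\in H$ and $u\in L_D$, the functional $x\mapsto J_u(x,y)$ is convex on $H$. (5) For all $x\in H$ and $u\in L_D$, the functional $y\mapsto J_u(x,y)$ is concave on $H$. Let $u\in L_D$ be fixed. Then there exists at least one saddle point $(x_u,y_u)\in H\times H$ of the functional $J_u$ which solves the boundary value problem $$\Delta^2x(k-1)=F_x(k,x(k),y(k),u(k)),\qquad \Delta^2y(k-1)=-F_y(k,x(k),y(k),u(k))\qquad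 (k\in[1,T]),$$ $$x(0)=x(T+1)=y(0)=y(T+1)=0.$$
   Context: For integers $a<b$, $[a,b]$ denotes the discrete interval $\{a,a+1,\dots,b\}$ (discrete topology). $\Delta x(k)=x(k+1)-x(k)$ is the forward difference operator and $\Delta^2x(k-1)=x(k+1)-2x(k)+x(k-1)$. $H=\{x:[0,T+1]\to\mathbb{R}: x(0)=x(T+1)=0\}$ with norm $\|x\|=\big(\sum_{k=1}^{T+1}|\Delta x(k-1)|^2\big)^{1/2}$ (a finite-dimensional Hilbert space). $c_2$ is the smallest positive constant such that $\sum_{k=1}^T|x(k)|^2\le c_2\sum_{k=1}^{T+1}|\Delta x(k-1)|^2$ for all $x\in H$. $L_D=\{u:[1,T]\to\mathbb{R}: \max_{k\in[1,T]}|u(k)|\le D\}$. For $u\in L_D$, the action functional $J_u:H\times H\to\mathbb{R}$ is $$J_u(x,y)=\sum_{k=1}^{T+1}\left(\frac{|\Delta x(k-1)|^2}{2}-\frac{|\Delta y(k-1)|^2}{2}\right)+\sum_{k=1}^TF(k,x(k),y(k),u(k)).$$ A saddle point of $J_u$ is a pair $(\overline x,\overline y)\in H\times H$ with $J_u(\overline x,y)\le J_u(\overline x,\overline y)\le J_u(x,\overline y)$ for all $x,y\in H$. *)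

theory Defs
  imports "HOL-Analysis.Analysis" "HOL-Library.Function_Algebras"
begin

text \<open>
  Functions with values in a real vector space form a real vector space under pointwise
  operations, so that \<^const>\<open>convex_on\<close> and \<^const>\<open>concave_on\<close> apply to functionals on sets of
  functions.
\<close>

instantiation "fun" :: (type, real_vector) real_vector
begin

definition scaleR_fun :: "real \<Rightarrow> ('a \<Rightarrow> 'b) \<Rightarrow> 'a \<Rightarrow> 'b"
  where "scaleR_fun r f = (\<lambda>k. r *\<^sub>R f k)"

instance
  by standard (simp_all add: scaleR_fun_def fun_eq_iff scaleR_add_right scaleR_add_left)

end

definition fwd_diff :: "(nat \<Rightarrow> real) \<Rightarrow> nat \<Rightarrow> real"
  where "fwd_diff x k = x (k + 1) - x k"

lemma fwd_diff_twice:
  assumes "k \<ge> 1"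
  shows "fwd_diff (fwd_diff x) (k - 1) = x (k + 1) - 2 * x k + x (k - 1)"
  using assms by (simp add: fwd_diff_def)

text \<open>
  Functions on a discrete interval are represented by their extensions by zero to all of
  \<^typ>\<open>nat\<close>; this makes the representation unique and compatible with the pointwise vector space
  structure. In \<open>space_H T\<close> the interval is \<open>{0..T + 1}\<close>, in \<open>space_L T D\<close> it is \<open>{1..T}\<close>.
\<close>

definition space_H :: "nat \<Rightarrow> (nat \<Rightarrow> real) set"
  where "space_H T = {x. x 0 = 0 \<and> x (T + 1) = 0 \<and> (\<forall>k. k \<notin> {0..T + 1} \<longrightarrow> x k = 0)}"

definition space_L :: "nat \<Rightarrow> real \<Rightarrow> (nat \<Rightarrow> real) set"
  where "space_L T D =
    {u. (MAX k\<in>{1..T}. \<bar>u k\<bar>) \<le> D \<and> (\<forall>k. k \<notin> {1..T} \<longrightarrow> u k = 0)}"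

definition poincare_const :: "nat \<Rightarrow> real \<Rightarrow> bool"
  where "poincare_const T c \<longleftrightarrow> 0 < c \<and>
    (\<forall>x\<in>space_H T. (\<Sum>k=1..T. \<bar>x k\<bar>^2) \<le> c * (\<Sum>k=1..T+1. \<bar>fwd_diff x (k - 1)\<bar>^2))"

definition c2 :: "nat \<Rightarrow> real"
  where "c2 T = (LEAST c. poincare_const T c)"

text \<open>The least constant is attained, so that the description above is proper.\<close>

lemma poincare_const_exists: "\<exists>c. poincare_const T c"
proof -
  define c where "c = real (T + 1) * real (T + 1)"
  have "(\<Sum>k=1..T. \<bar>x k\<bar>^2) \<le> c * (\<Sum>k=1..T+1. \<bar>fwd_diff x (k - 1)\<bar>^2)"
    if x: "x \<in> space_H T" for x
  proof -
    define S where "S = (\<Sum>k=1..T+1. \<bar>fwd_diff x (k - 1)\<bar>^2)"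
    have S0: "0 \<le> S" unfolding S_def by (simp add: sum_nonneg)
    have pt: "\<bar>x k\<bar>^2 \<le> real (T + 1) * S" if k: "k \<in> {1..T}" for k
    proof -
      have tele: "(\<Sum>j=1..n. fwd_diff x (j - 1)) = x n" for n
        using x by (induction n) (auto simp: fwd_diff_def space_H_def)
      have "(x k)\<^sup>2 = (\<Sum>j=1..k. fwd_diff x (j - 1))\<^sup>2"
        using tele[of k] by simp
      also have "\<dots> \<le> (\<Sum>j=1..k. (fwd_diff x (j - 1))\<^sup>2) * real (card {1..k})"
        by (rule order_trans[OF sum_squared_le_sum_of_squares]) (simp_all add: mult.commute)
      also have "\<dots> \<le> S * real (T + 1)"
      proof (rule mult_mono)
        show "(\<Sum>j=1..k. (fwd_diff x (j - 1))\<^sup>2) \<le> S"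
          unfolding S_def power2_abs using k by (intro sum_mono2) auto
      qed (use k S0 in auto)
      finally show ?thesis by (simp add: mult.commute)
    qed
    have "(\<Sum>k=1..T. \<bar>x k\<bar>^2) \<le> (\<Sum>k=1..T. real (T + 1) * S)"
      using pt by (rule sum_mono)
    also have "\<dots> = real T * (real (T + 1) * S)" by simp
    also have "\<dots> \<le> real (T + 1) * (real (T + 1) * S)"
      using S0 by (intro mult_right_mono) auto
    finally show ?thesis by (simp add: c_def S_def mult.assoc)
  qed
  moreover have "0 < c" by (simp add: c_def)
  ultimately show ?thesis unfolding poincare_const_def by blast
qed

lemma poincare_const_c2:
  assumes "T \<ge> 1"
  shows "poincare_const T (c2 T)" and "\<And>c. poincare_const T c \<Longrightarrow> c2 T \<le> c"
proof -
  let ?A = "{c. poincare_const T c}"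
  let ?m = "Inf ?A"
  define e :: "nat \<Rightarrow> real" where "e = (\<lambda>k. if k = 1 then 1 else 0)"
  have e: "e \<in> space_H T" using assms by (auto simp: space_H_def e_def)
  define a where "a = (\<Sum>k=1..T+1. \<bar>fwd_diff e (k - 1)\<bar>^2)"
  have one: "(\<Sum>k=1..T. \<bar>e k\<bar>^2) = 1"
  proof -
    have "(\<Sum>k=1..T. \<bar>e k\<bar>^2) = (\<Sum>k=1..T. if k = 1 then 1 else 0)"
      by (rule sum.cong) (auto simp: e_def)
    then show ?thesis using assms by simp
  qed
  have low: "1 \<le> c * a" if "poincare_const T c" for c
    using that e one unfolding poincare_const_def a_def by fastforce
  have a0: "0 \<le> a" unfolding a_def by (simp add: sum_nonneg)
  have "a \<noteq> 0" using low poincare_const_exists[of T] by fastforce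
  with a0 have a: "0 < a" by simp
  have lb: "1 / a \<le> c" if "poincare_const T c" for c
    using low[OF that] a by (simp add: field_simps)
  have ne: "?A \<noteq> {}" using poincare_const_exists by blast
  have bdd: "bdd_below ?A" using lb by (intro bdd_belowI[of _ "1 / a"]) simp
  have "1 / a \<le> ?m" using ne lb by (auto intro: cInf_greatest)
  with a have m0: "0 < ?m" by (meson less_le_trans zero_less_divide_1_iff)
  have "(\<Sum>k=1..T. \<bar>x k\<bar>^2) \<le> ?m * (\<Sum>k=1..T+1. \<bar>fwd_diff x (k - 1)\<bar>^2)"
    if x: "x \<in> space_H T" for x
  proof -
    let ?L = "\<Sum>k=1..T. \<bar>x k\<bar>^2" and ?R = "\<Sum>k=1..T+1. \<bar>fwd_diff x (k - 1)\<bar>^2"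
    have R0: "0 \<le> ?R" by (simp add: sum_nonneg)
    have all: "?L \<le> c * ?R" if "poincare_const T c" for c
      using that x unfolding poincare_const_def by blast
    show ?thesis
    proof (cases "?R = 0")
      case True
      obtain c where "poincare_const T c" using poincare_const_exists by blast
      from all[OF this] show ?thesis unfolding True by simp
    next
      case False
      with R0 have R: "0 < ?R" by linarith
      have "?L / ?R \<le> c" if "poincare_const T c" for c
        using all[OF that] R by (simp add: pos_divide_le_eq)
      then have "?L / ?R \<le> ?m" using ne by (auto intro: cInf_greatest)
      with R show ?thesis by (simp add: pos_divide_le_eq)
    qed
  qed
  with m0 have m: "poincare_const T ?m" unfolding poincare_const_def by blast
  have min: "?m \<le> c" if "poincare_const T c" for c
    using that bdd by (auto intro: cInf_lower)
  have eq: "c2 T = ?m" unfolding c2_def using m min by (rule Least_equality)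
  show "poincare_const T (c2 T)" unfolding eq by (rule m)
  show "c2 T \<le> c" if "poincare_const T c" for c unfolding eq using that by (rule min)
qed

definition action_J ::
  "(nat \<Rightarrow> real \<Rightarrow> real \<Rightarrow> real \<Rightarrow> real) \<Rightarrow> nat \<Rightarrow> (nat \<Rightarrow> real)
    \<Rightarrow> (nat \<Rightarrow> real) \<Rightarrow> (nat \<Rightarrow> real) \<Rightarrow> real"
  where "action_J F T u x y =
    (\<Sum>k=1..T+1. \<bar>fwd_diff x (k - 1)\<bar>^2 / 2 - \<bar>fwd_diff y (k - 1)\<bar>^2 / 2)
    + (\<Sum>k=1..T. F k (x k) (y k) (u k))"

definition saddle_point ::
  "('a \<Rightarrow> 'b \<Rightarrow> real) \<Rightarrow> 'a set \<Rightarrow> 'b set \<Rightarrow> 'a \<Rightarrow> 'b \<Rightarrow> bool"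
  where "saddle_point J X Y x0 y0 \<longleftrightarrow> x0 \<in> X \<and> y0 \<in> Y \<and>
    (\<forall>x\<in>X. \<forall>y\<in>Y. J x0 y \<le> J x0 y0 \<and> J x0 y0 \<le> J x y0)"

definition partial_x ::
  "(nat \<Rightarrow> real \<Rightarrow> real \<Rightarrow> real \<Rightarrow> real) \<Rightarrow> nat \<Rightarrow> real \<Rightarrow> real \<Rightarrow> real \<Rightarrow> real"
  where "partial_x F k x y u = deriv (\<lambda>s. F k s y u) x"

definition partial_y ::
  "(nat \<Rightarrow> real \<Rightarrow> real \<Rightarrow> real \<Rightarrow> real) \<Rightarrow> nat \<Rightarrow> real \<Rightarrow> real \<Rightarrow> real \<Rightarrow> real"
  where "partial_y F k x y u = deriv (\<lambda>s. F k x s u) y"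

end

theory Submission
  imports Defs
begin

text \<open>
  On compact convex sets, and when maximizers in \<open>y\<close> are unique, let \<open>x\<^sub>0\<close> minimize
  \<open>\<phi> x = max\<^sub>y J x y\<close> and let \<open>y\<^sub>0\<close> be the maximizer for \<open>x\<^sub>0\<close>. Moving from \<open>x\<^sub>0\<close> a
  fraction \<open>t\<close> of the way to \<open>x\<close> does not decrease \<open>\<phi>\<close>, so convexity gives
  \<open>J x\<^sub>0 y\<^sub>0 \<le> J x y\<^sub>t\<close> for the maximizer \<open>y\<^sub>t\<close> at the moved point; as \<open>t \<rightarrow> 0\<close>, \<open>y\<^sub>t\<close> tends
  to \<open>y\<^sub>0\<close> and \<open>(x\<^sub>0, y\<^sub>0)\<close> is a saddle point. Applied to \<open>J x y - \<Sum>(y k)\<^sup>2 / (n + 1)\<close> on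
  the box of radius \<open>n\<close>, this yields points \<open>(a\<^sub>n, b\<^sub>n)\<close> with \<open>J a\<^sub>n 0 \<le> J 0 b\<^sub>n\<close>. Since \<open>\<alpha>\<^sub>1\<close> and
  \<open>\<alpha>\<^sub>2\<close> lie below \<open>1 / (2 c\<^sub>2)\<close>, the functionals \<open>J _ 0\<close> and \<open>- J 0 _\<close> are coercive, so these
  points are bounded and a limit point is a saddle point of \<open>J\<close> on the whole space. The difference
  equations are the first-order conditions at the two partial extrema.
\<close>

section \<open>Minimax on compact sets\<close>

lemma saddle_point_compact:
  fixes J :: "('a::countable \<Rightarrow> real) \<Rightarrow> 'b::metric_space \<Rightarrow> real"
  assumes X: "compact X" "X \<noteq> {}" and Y: "compact Y" "Y \<noteq> {}"
    and cont: "continuous_on (X \<times> Y) (\<lambda>(x, y). J x y)"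
    and conv: "\<And>y. y \<in> Y \<Longrightarrow> convex_on X (\<lambda>x. J x y)"
    and uniq: "\<And>x y y'. \<lbrakk>x \<in> X; y \<in> Y; y' \<in> Y;
      \<forall>z\<in>Y. J x z \<le> J x y; \<forall>z\<in>Y. J x z \<le> J x y'\<rbrakk> \<Longrightarrow> y = y'"
  shows "\<exists>x0 y0. saddle_point J X Y x0 y0"
proof -
  have lim: "(\<lambda>n. J (a n) (b n)) \<longlonglongrightarrow> J x y"
    if "a \<longlonglongrightarrow> x" "b \<longlonglongrightarrow> y" "x \<in> X" "y \<in> Y" "\<And>n. a n \<in> X" "\<And>n. b n \<in> Y" for a b x y
    using continuous_on_tendsto_compose[OF cont tendsto_Pair[OF that(1,2)]] that by simp
  have "\<exists>y\<in>Y. \<forall>z\<in>Y. J x z \<le> J x y" if "x \<in> X" for x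
  proof (rule continuous_attains_sup[OF Y])
    show "continuous_on Y (J x)"
      using that by (intro continuous_on_compose2[OF cont, of Y "\<lambda>y. (x, y)", simplified])
        (auto intro!: continuous_intros)
  qed
  then obtain M where MY: "\<And>x. x \<in> X \<Longrightarrow> M x \<in> Y"
    and M: "\<And>x y. x \<in> X \<Longrightarrow> y \<in> Y \<Longrightarrow> J x y \<le> J x (M x)"
    by metis
  define m where "m = (INF x\<in>X. J x (M x))"
  \<comment> \<open>For a fixed \<open>y1\<close>, \<open>J x (M x)\<close> dominates
    \<open>J x y1\<close>, which is bounded below on the compact \<open>X\<close>. The infimum
    \<open>m\<close> is then approached by a sequence, so continuity of the maximum in
    \<open>x\<close> does not enter.\<close>
  have bdd: "bdd_below ((\<lambda>x. J x (M x)) ` X)"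
  proof -
    obtain y1 where y1: "y1 \<in> Y" using Y by auto
    have "continuous_on X (\<lambda>x. J x y1)"
      using y1 by (intro continuous_on_compose2[OF cont, of X "\<lambda>x. (x, y1)", simplified])
        (auto intro!: continuous_intros)
    then obtain x1 where "\<forall>x\<in>X. J x1 y1 \<le> J x y1"
      using continuous_attains_inf[OF X] by blast
    then show ?thesis
      using M[OF _ y1] by (intro bdd_belowI2[of _ "J x1 y1"]) (meson order_trans)
  qed
  have m: "m \<le> J x (M x)" if "x \<in> X" for x
    unfolding m_def using bdd that by (rule cINF_lower)
  have "\<exists>x\<in>X. J x (M x) < m + 1 / real (Suc n)" for n
    using cInf_lessD[of "(\<lambda>x. J x (M x)) ` X" "m + 1 / real (Suc n)"] X(2) unfolding m_def by auto
  then obtain xs where xsX: "\<And>n. xs n \<in> X"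
    and xs: "\<And>n. J (xs n) (M (xs n)) < m + 1 / real (Suc n)" by metis
  \<comment> \<open>Functions on a countable type form a metric space in the product topology, so
    compactness of \<open>X\<close> yields a convergent subsequence.\<close>
  obtain x0 r where x0: "x0 \<in> X" and r: "strict_mono r" and xr: "(xs \<circ> r) \<longlonglongrightarrow> x0"
    using X(1) xsX unfolding compact_eq_seq_compact_metric seq_compact_def by metis
  \<comment> \<open>Lower semicontinuity of the maximum: for fixed \<open>y\<close> the bound by
    \<open>m\<close> plus an error passes to the limit. At \<open>y = M x0\<close> it shows that
    \<open>x0\<close> attains the infimum.\<close>
  have x0m: "J x0 y \<le> m" if y: "y \<in> Y" for y
  proof (rule LIMSEQ_le)
    show "(\<lambda>n. J ((xs \<circ> r) n) y) \<longlonglongrightarrow> J x0 y"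
      using lim[OF xr tendsto_const[of y]] x0 y xsX by simp
    have "(\<lambda>n. m + 1 / real (Suc n)) \<longlonglongrightarrow> m + 0"
      by (intro tendsto_intros LIMSEQ_Suc[OF lim_1_over_n])
    then have "((\<lambda>n. m + 1 / real (Suc n)) \<circ> r) \<longlonglongrightarrow> m"
      using r by (intro LIMSEQ_subseq_LIMSEQ) auto
    then show "(\<lambda>n. m + 1 / real (Suc (r n))) \<longlonglongrightarrow> m" by (simp add: o_def)
    show "\<exists>N. \<forall>n\<ge>N. J ((xs \<circ> r) n) y \<le> m + 1 / real (Suc (r n))"
      using M[OF xsX y] xs by (auto intro!: exI less_imp_le intro: le_less_trans)
  qed
  have "J x0 (M x0) \<le> J x (M x0)" if x: "x \<in> X" for x
  proof -
    define z where "z = (\<lambda>n. (1 - 1 / real (Suc n)) *\<^sub>R x0 + (1 / real (Suc n)) *\<^sub>R x)"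
    have "convex X" using conv MY[OF x] convex_on_imp_convex by blast
    then have zX: "z n \<in> X" for n
      unfolding z_def using x0 x by (intro convexD) auto
    obtain y' s where y': "y' \<in> Y" and s: "strict_mono s" and ys: "((\<lambda>n. M (z n)) \<circ> s) \<longlonglongrightarrow> y'"
      using Y(1) MY[OF zX] unfolding compact_eq_seq_compact_metric seq_compact_def by metis
    \<comment> \<open>Convergence in the product topology follows from continuity in
      \<open>t\<close>, coordinate by coordinate, of the segment from \<open>x0\<close> to
      \<open>x\<close>.\<close>
    have "z \<longlonglongrightarrow> x0"
    proof -
      have "continuous_on UNIV (\<lambda>t i. (1 - t) * x0 i + t * x i)"
        by (intro continuous_intros)
      then have "(\<lambda>n. (\<lambda>t i. (1 - t) * x0 i + t * x i) (1 / real (Suc n)))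
          \<longlonglongrightarrow> (\<lambda>i. (1 - 0) * x0 i + 0 * x i)"
        by (rule continuous_on_tendsto_compose)
          (auto intro: LIMSEQ_Suc[OF lim_1_over_n] simp del: of_nat_Suc)
      then show ?thesis by (simp add: z_def scaleR_fun_def plus_fun_def)
    qed
    then have zs: "(z \<circ> s) \<longlonglongrightarrow> x0" using s by (rule LIMSEQ_subseq_LIMSEQ)
    \<comment> \<open>A limit of maximizers along the segment maximizes \<open>J x0\<close>, so
      uniqueness identifies \<open>y'\<close> with \<open>M x0\<close>.\<close>
    have "J x0 y \<le> J x0 y'" if y: "y \<in> Y" for y
      using lim[OF zs tendsto_const[of y]] lim[OF zs ys] x0 y y' zX MY[OF zX] M[OF zX y]
      by (intro LIMSEQ_le[of "\<lambda>n. J ((z \<circ> s) n) y" _ "\<lambda>n. J ((z \<circ> s) n) (M (z (s n)))"]) auto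
    then have y'_eq: "y' = M x0"
      using x0 y' MY[OF x0] M[OF x0] by (intro uniq) auto
    have "J x0 (M x0) \<le> J x (M (z n))" for n
    proof -
      define t where "t = 1 / real (Suc n)"
      have t: "0 < t" "t \<le> 1" by (auto simp: t_def)
      have "J x0 (M x0) \<le> J (z n) (M (z n))"
        using x0m[OF MY[OF x0]] m[OF zX] by (rule order_trans)
      also have "\<dots> \<le> (1 - t) * J x0 (M (z n)) + t * J x (M (z n))"
        using convex_onD[OF conv[OF MY[OF zX[of n]]], of t x0 x] t x0 x by (simp add: z_def t_def)
      \<comment> \<open>As \<open>M x0\<close> maximizes \<open>J x0\<close>, the
        \<open>1 - t\<close> shares on both sides match and cancel; the remaining factor
        \<open>t\<close> is positive.\<close>
      also have "\<dots> \<le> (1 - t) * J x0 (M x0) + t * J x (M (z n))"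
        using t M[OF x0 MY[OF zX]] by (intro add_right_mono mult_left_mono) auto
      finally have "t * J x0 (M x0) \<le> t * J x (M (z n))" by (simp add: algebra_simps)
      with t show ?thesis by simp
    qed
    then show ?thesis
      using lim[OF tendsto_const[of x] ys] x y' MY[OF zX] unfolding y'_eq
      by (intro LIMSEQ_le_const[of "\<lambda>n. J x (M (z (s n)))"]) (auto simp: o_def)
  qed
  then have "saddle_point J X Y x0 (M x0)"
    unfolding saddle_point_def using x0 MY M by auto
  then show ?thesis by blast
qed

section \<open>Compact convex boxes in the sequence space\<close>

lemma space_H_eq_0:
  assumes "x \<in> space_H T" "k \<notin> {1..T}"
  shows "x k = 0"
proof -
  have "k = 0 \<or> k = T + 1 \<or> k \<notin> {0..T + 1}" using assms(2) by auto
  then show ?thesis using assms(1) by (auto simp: space_H_def)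
qed

lemma zero_in_space_H: "0 \<in> space_H T"
  by (simp add: space_H_def)

text \<open>Tychonoff: for \<open>R \<ge> 0\<close> the box is a product of intervals at
  \<open>1..T\<close> and of singletons \<open>{0}\<close> elsewhere. For negative \<open>R\<close>
  the zero coordinates violate the bound and the set is empty.\<close>

lemma compact_space_H_box: "compact {x \<in> space_H T. \<forall>k. \<bar>x k\<bar> \<le> R}"
proof (cases "0 \<le> R")
  case True
  have "{x \<in> space_H T. \<forall>k. \<bar>x k\<bar> \<le> R} = (\<Pi>\<^sub>E k\<in>UNIV. if k \<in> {1..T} then {-R..R} else {0})"
    (is "?A = ?B")
  proof
    show "?A \<subseteq> ?B"
    proof
      fix x assume x: "x \<in> ?A"
      then have "x k = 0" if "k \<notin> {1..T}" for k
        using that by (auto intro: space_H_eq_0)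
      then show "x \<in> ?B" using x by (auto simp: PiE_iff abs_le_iff minus_le_iff)
    qed
    show "?B \<subseteq> ?A"
    proof
      fix x assume "x \<in> ?B"
      then have x: "x k \<in> (if k \<in> {1..T} then {-R..R} else {0})" for k by (auto simp: PiE_iff)
      have "x k = 0" if "k \<notin> {1..T}" for k using x[of k] that by auto
      moreover have "\<bar>x k\<bar> \<le> R" for k
        using x[of k] True by (auto split: if_splits)
      ultimately show "x \<in> ?A" by (auto simp: space_H_def)
    qed
  qed
  moreover have "compactin (product_topology (\<lambda>_. euclidean) UNIV) ?B"
    by (subst compactin_PiE) auto
  ultimately show ?thesis by (simp add: euclidean_product_topology)
next
  case False
  then have "{x \<in> space_H T. \<forall>k. \<bar>x k\<bar> \<le> R} = {}" by (auto dest!: spec[of _ 0])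
  then show ?thesis by (metis compact_empty)
qed

lemma space_H_bounded:
  assumes "x \<in> space_H T"
  obtains R where "\<And>k. \<bar>x k\<bar> \<le> R"
proof
  fix k
  show "\<bar>x k\<bar> \<le> (\<Sum>i=1..T. \<bar>x i\<bar>)"
  proof (cases "k \<in> {1..T}")
    case True
    then show ?thesis by (intro member_le_sum) auto
  next
    case False
    then show ?thesis using space_H_eq_0[OF assms] by (simp add: sum_nonneg)
  qed
qed

lemma convex_space_H_box: "convex {x \<in> space_H T. \<forall>k. \<bar>x k\<bar> \<le> R}"
proof (rule convexI)
  fix x y :: "nat \<Rightarrow> real" and s t :: real
  assume x: "x \<in> {x \<in> space_H T. \<forall>k. \<bar>x k\<bar> \<le> R}" and y: "y \<in> {x \<in> space_H T. \<forall>k. \<bar>x k\<bar> \<le> R}"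
    and st: "0 \<le> s" "0 \<le> t" "s + t = 1"
  have "\<bar>s * x k + t * y k\<bar> \<le> R" for k
  proof -
    have "\<bar>s * x k + t * y k\<bar> \<le> s * \<bar>x k\<bar> + t * \<bar>y k\<bar>"
      using st abs_triangle_ineq[of "s * x k" "t * y k"] by (simp add: abs_mult)
    also have "\<dots> \<le> s * R + t * R"
      using x y st by (intro add_mono mult_left_mono) auto
    also have "\<dots> = R" using st by (simp flip: distrib_right)
    finally show ?thesis .
  qed
  then show "s *\<^sub>R x + t *\<^sub>R y \<in> {x \<in> space_H T. \<forall>k. \<bar>x k\<bar> \<le> R}"
    using x y by (auto simp: space_H_def scaleR_fun_def)
qed

lemma space_H_sum_squares_eq_0:
  assumes "x \<in> space_H T" "(\<Sum>k=1..T. (x k)\<^sup>2) = 0"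
  shows "x = 0"
proof
  fix k
  have "x k = 0" if "k \<in> {1..T}"
    using assms(2) that by (subst (asm) sum_nonneg_eq_0_iff) auto
  then show "x k = 0 k" using space_H_eq_0[OF assms(1)] by auto
qed

section \<open>Saddle points under coercivity\<close>

text \<open>The quadratic penalty makes a concave functional strictly concave: by the parallelogram
  identity the midpoint of two maximizers gains at least \<open>e / 4\<close> times their squared
  distance. This provides the uniqueness that \<open>saddle_point_compact\<close> asks for.\<close>

lemma perturbed_maximizer_unique:
  fixes g :: "(nat \<Rightarrow> real) \<Rightarrow> real"
  assumes g: "concave_on Y g" and Y: "Y \<subseteq> space_H T" and e: "e > 0"
    and y: "y \<in> Y" "y' \<in> Y"
    and max: "\<forall>z\<in>Y. g z - e * (\<Sum>k=1..T. (z k)\<^sup>2) \<le> g y - e * (\<Sum>k=1..T. (y k)\<^sup>2)"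
    and max': "\<forall>z\<in>Y. g z - e * (\<Sum>k=1..T. (z k)\<^sup>2) \<le> g y' - e * (\<Sum>k=1..T. (y' k)\<^sup>2)"
  shows "y = y'"
proof -
  define q where "q z = (\<Sum>k=1..T. (z k)\<^sup>2)" for z :: "nat \<Rightarrow> real"
  define z where "z = (1/2::real) *\<^sub>R y + (1/2::real) *\<^sub>R y'"
  have "convex Y" using g by (rule concave_on_imp_convex)
  then have zY: "z \<in> Y" unfolding z_def using y by (intro convexD) auto
  have gz: "g y / 2 + g y' / 2 \<le> g z"
    using concave_onD[OF g, of "1/2" y y'] y by (simp add: z_def)
  have "q z = (\<Sum>k=1..T. (y k)\<^sup>2 / 2 + (y' k)\<^sup>2 / 2 - ((y - y') k)\<^sup>2 / 4)"
    unfolding q_def z_def by (intro sum.cong) (auto simp: scaleR_fun_def power2_eq_square field_simps)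
  then have qz: "q z = q y / 2 + q y' / 2 - q (y - y') / 4"
    by (simp add: q_def sum.distrib sum_subtractf sum_divide_distrib)
  have "g z - e * q z \<le> g y - e * q y" "g z - e * q z \<le> g y' - e * q y'"
    using max max' zY by (auto simp: q_def)
  with gz have "e * (q (y - y') / 4) \<le> 0" unfolding qz by (simp add: algebra_simps)
  with e have "q (y - y') \<le> 0" by (simp add: mult_le_0_iff)
  moreover have "0 \<le> q (y - y')" by (simp add: q_def sum_nonneg)
  moreover have "y - y' \<in> space_H T"
    using subsetD[OF Y y(1)] subsetD[OF Y y(2)] by (auto simp: space_H_def)
  ultimately have "y - y' = 0"
    by (intro space_H_sum_squares_eq_0) (auto simp: q_def)
  then show ?thesis by simp
qed

text \<open>Coercivity is phrased as boundedness of level sets in the sup norm along the axes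
  \<open>y = 0\<close> and \<open>x = 0\<close>, because the approximate saddle points are confined
  by comparison with the zero function.\<close>

lemma saddle_point_coercive:
  fixes J :: "(nat \<Rightarrow> real) \<Rightarrow> (nat \<Rightarrow> real) \<Rightarrow> real"
  assumes cont: "continuous_on (space_H T \<times> space_H T) (\<lambda>(x, y). J x y)"
    and conv: "\<And>y. y \<in> space_H T \<Longrightarrow> convex_on (space_H T) (\<lambda>x. J x y)"
    and conc: "\<And>x. x \<in> space_H T \<Longrightarrow> concave_on (space_H T) (\<lambda>y. J x y)"
    and coercive_x: "\<And>C. \<exists>R. \<forall>x\<in>space_H T. J x 0 \<le> C \<longrightarrow> (\<forall>k. \<bar>x k\<bar> \<le> R)"
    and coercive_y: "\<And>C. \<exists>R. \<forall>y\<in>space_H T. J 0 y \<ge> C \<longrightarrow> (\<forall>k. \<bar>y k\<bar> \<le> R)"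
  shows "\<exists>x0 y0. saddle_point J (space_H T) (space_H T) x0 y0"
proof -
  define H where "H = space_H T"
  define B where "B R = {x \<in> H. \<forall>k. \<bar>x k\<bar> \<le> R}" for R :: real
  define q where "q y = (\<Sum>k=1..T. (y k)\<^sup>2)" for y :: "nat \<Rightarrow> real"
  define e where "e n = 1 / real (Suc n)" for n
  have e: "e n > 0" for n by (simp add: e_def)
  have q: "q y \<ge> 0" "q 0 = 0" for y by (auto simp: q_def sum_nonneg)
  have H0: "0 \<in> H" by (simp add: H_def zero_in_space_H)
  have BH: "B R \<subseteq> H" for R by (auto simp: B_def)
  have B0: "0 \<in> B R" if "R \<ge> 0" for R using that H0 by (auto simp: B_def)
  have cB: "compact (B R)" for R unfolding B_def H_def by (rule compact_space_H_box)
  have vB: "convex (B R)" for R unfolding B_def H_def by (rule convex_space_H_box)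
  have qc: "continuous_on S q" for S
    unfolding q_def by (intro continuous_intros continuous_on_subset[OF continuous_on_product_coordinates]) auto
  have "\<exists>x y. saddle_point (\<lambda>x y. J x y - e n * q y) (B n) (B n) x y" for n :: nat
  proof (rule saddle_point_compact)
    show "continuous_on (B n \<times> B n) (\<lambda>(x, y). J x y - e n * q y)"
      unfolding case_prod_beta
      using BH[of n] by (intro continuous_intros continuous_on_subset[OF cont[unfolded case_prod_beta]]
          continuous_on_compose2[OF qc]) (auto simp: H_def)
    show "convex_on (B n) (\<lambda>x. J x y - e n * q y)" if "y \<in> B n" for y
      using convex_on_subset[OF conv[of y] _ vB, of n] that BH[of n] vB
      by (intro convex_on_diff) (auto simp: H_def concave_on_const)
    show "y = y'" if "x \<in> B n" "y \<in> B n" "y' \<in> B n"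
      "\<forall>z\<in>B n. J x z - e n * q z \<le> J x y - e n * q y"
      "\<forall>z\<in>B n. J x z - e n * q z \<le> J x y' - e n * q y'" for x y y'
    proof (rule perturbed_maximizer_unique[OF _ _ e[of n] that(2,3)])
      show "concave_on (B n) (J x)"
        using conc[of x] that(1) BH[of n] vB[of n] unfolding concave_on_def H_def
        by (auto intro: convex_on_subset)
    qed (use BH that in \<open>auto simp: H_def q_def\<close>)
  qed (use cB B0[of n] in auto)
  then obtain a b where ab: "\<And>n. saddle_point (\<lambda>x y. J x y - e n * q y) (B (real n)) (B (real n)) (a n) (b n)"
    by metis
  have aH: "a n \<in> H" and bH: "b n \<in> H" for n
    using ab[of n] BH unfolding saddle_point_def by blast+
  \<comment> \<open>Chaining the two saddle inequalities eliminates the value at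
    \<open>(a n, b n)\<close>. The penalty at \<open>b n\<close> has a favourable sign and is
    dropped; the one at the fixed \<open>y\<close> vanishes as \<open>e n\<close> tends to
    0.\<close>
  have key: "J (a n) y - e n * q y \<le> J x (b n)" if "x \<in> B n" "y \<in> B n" for x y n
  proof -
    have "J (a n) y - e n * q y \<le> J x (b n) - e n * q (b n)"
      using ab[of n] that unfolding saddle_point_def by (meson order_trans)
    also have "\<dots> \<le> J x (b n)" using e[of n] q(1)[of "b n"] by simp
    finally show ?thesis .
  qed
  have key0: "J (a n) 0 \<le> J 0 (b n)" for n
    using key[of 0 n 0] B0[of n] q by simp
  \<comment> \<open>Outside the box \<open>B R\<close> the values of \<open>J 0\<close> lie below
    \<open>J 0 0\<close>; inside, compactness gives a maximum. This upper bound confines the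
    \<open>a n\<close> through \<open>key0\<close>.\<close>
  have "\<exists>M. \<forall>y\<in>H. J 0 y \<le> M"
  proof -
    obtain R where R: "\<And>y. y \<in> H \<Longrightarrow> J 0 y \<ge> J 0 0 \<Longrightarrow> y \<in> B R"
      using coercive_y[of "J 0 0"] by (auto simp: B_def H_def)
    have "continuous_on (B R) (J 0)"
      using H0 BH[of R] by (intro continuous_on_compose2[OF cont, of "B R" "\<lambda>y. (0, y)", simplified])
        (auto simp: H_def intro!: continuous_intros)
    then obtain m where m: "\<And>y. y \<in> B R \<Longrightarrow> J 0 y \<le> J 0 m"
      using continuous_attains_sup[OF cB, of R "J 0"] R[OF H0] by auto
    have "J 0 y \<le> J 0 m" if "y \<in> H" for y
      using R[OF that] m[of y] m[OF R[OF H0]] by (cases "J 0 y \<ge> J 0 0") auto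
    then show ?thesis by blast
  qed
  then obtain M where M: "\<And>y. y \<in> H \<Longrightarrow> J 0 y \<le> M" by blast
  obtain R1 where R1: "\<And>x. x \<in> H \<Longrightarrow> J x 0 \<le> M \<Longrightarrow> x \<in> B R1"
    using coercive_x[of M] by (auto simp: B_def H_def)
  have aB: "a n \<in> B R1" for n
    using R1[OF aH] key0[of n] M[OF bH[of n]] by (meson order_trans)
  \<comment> \<open>The roles now swap: the minimum of \<open>J _ 0\<close> over the box containing
    all \<open>a n\<close> bounds \<open>J 0 (b n)\<close> from below, which confines the
    \<open>b n\<close>.\<close>
  have "continuous_on (B R1) (\<lambda>x. J x 0)"
    using H0 BH[of R1] by (intro continuous_on_compose2[OF cont, of "B R1" "\<lambda>x. (x, 0)", simplified])
      (auto simp: H_def intro!: continuous_intros)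
  then obtain m where m: "\<And>x. x \<in> B R1 \<Longrightarrow> J m 0 \<le> J x 0"
    using continuous_attains_inf[OF cB, of R1 "\<lambda>x. J x 0"] aB by auto
  obtain R2 where R2: "\<And>y. y \<in> H \<Longrightarrow> J 0 y \<ge> J m 0 \<Longrightarrow> y \<in> B R2"
    using coercive_y[of "J m 0"] by (auto simp: B_def H_def)
  have bB: "b n \<in> B R2" for n
    using R2[OF bH] key0[of n] m[OF aB[of n]] by (meson order_trans)
  have "seq_compact (B R1 \<times> B R2)"
    using compact_Times[OF cB cB] by (simp add: compact_eq_seq_compact_metric)
  moreover have "\<forall>n. (a n, b n) \<in> B R1 \<times> B R2" using aB bB by simp
  ultimately obtain l r where l: "l \<in> B R1 \<times> B R2" and r: "strict_mono r"
    and lr: "((\<lambda>n. (a n, b n)) \<circ> r) \<longlonglongrightarrow> l"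
    by (rule seq_compactE)
  obtain x0 y0 where xy: "l = (x0, y0)" by (cases l)
  have x0: "x0 \<in> H" and y0: "y0 \<in> H" using l BH xy by auto
  have ar: "(a \<circ> r) \<longlonglongrightarrow> x0" and br: "(b \<circ> r) \<longlonglongrightarrow> y0"
    using tendsto_fst[OF lr] tendsto_snd[OF lr] by (auto simp: xy o_def)
  have lim: "(\<lambda>n. J (c n) (d n)) \<longlonglongrightarrow> J x y"
    if "c \<longlonglongrightarrow> x" "d \<longlonglongrightarrow> y" "x \<in> H" "y \<in> H" "\<And>n. c n \<in> H" "\<And>n. d n \<in> H" for c d x y
    using continuous_on_tendsto_compose[OF cont tendsto_Pair[OF that(1,2)]] that by (simp add: H_def)
  \<comment> \<open>Both saddle inequalities are instances: \<open>x = x0\<close> gives maximality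
    of \<open>y0\<close>, and \<open>y = y0\<close> gives minimality of \<open>x0\<close>.\<close>
  have main: "J x0 y \<le> J x y0" if x: "x \<in> H" and y: "y \<in> H" for x y
  proof (rule LIMSEQ_le)
    have "(\<lambda>n. e n) \<longlonglongrightarrow> 0" unfolding e_def by (rule LIMSEQ_Suc[OF lim_1_over_n])
    then have er: "(e \<circ> r) \<longlonglongrightarrow> 0" using r by (intro LIMSEQ_subseq_LIMSEQ) auto
    have "(\<lambda>n. J ((a \<circ> r) n) y) \<longlonglongrightarrow> J x0 y"
      using aH y x0 by (intro lim[OF ar]) auto
    then have "(\<lambda>n. J ((a \<circ> r) n) y - (e \<circ> r) n * q y) \<longlonglongrightarrow> J x0 y - 0 * q y"
      by (intro tendsto_diff tendsto_mult er tendsto_const)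
    then show "(\<lambda>n. J ((a \<circ> r) n) y - (e \<circ> r) n * q y) \<longlonglongrightarrow> J x0 y" by simp
    show "(\<lambda>n. J x ((b \<circ> r) n)) \<longlonglongrightarrow> J x y0"
      using bH x y0 by (intro lim[OF _ br]) auto
    obtain Rx where Rx: "\<And>k. \<bar>x k\<bar> \<le> Rx" using space_H_bounded x unfolding H_def by blast
    obtain Ry where Ry: "\<And>k. \<bar>y k\<bar> \<le> Ry" using space_H_bounded y unfolding H_def by blast
    \<comment> \<open>The competitors \<open>x\<close> and \<open>y\<close> are fixed, so they
      belong to every box of large enough radius; \<open>r n \<ge> n\<close> ensures this along the
      subsequence.\<close>
    obtain N :: nat where N: "Rx \<le> N" "Ry \<le> N"
      using real_arch_simple[of "max Rx Ry"] by auto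
    have "J ((a \<circ> r) n) y - (e \<circ> r) n * q y \<le> J x ((b \<circ> r) n)" if "n \<ge> N" for n
    proof -
      have "real N \<le> real (r n)" using that seq_suble[OF r, of n] by linarith
      then have "\<bar>x k\<bar> \<le> real (r n)" "\<bar>y k\<bar> \<le> real (r n)" for k
        using Rx[of k] Ry[of k] N by linarith+
      then have "x \<in> B (r n)" "y \<in> B (r n)"
        using x y by (auto simp: B_def)
      then show ?thesis using key by simp
    qed
    then show "\<exists>N. \<forall>n\<ge>N. J ((a \<circ> r) n) y - (e \<circ> r) n * q y \<le> J x ((b \<circ> r) n)" by blast
  qed
  then show ?thesis
    using x0 y0 unfolding saddle_point_def H_def by blast
qed


section \<open>Coercivity from the Poincare inequality\<close>

text \<open>The Poincare inequality bounds the difference term below by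
  \<open>1 / (2 * c2 T)\<close> times the sum of squares, and this coefficient exceeds \<alpha> by a
  positive margin. The single-variable form serves both \<open>F\<close> in \<open>x\<close> and
  \<open>- F\<close> in \<open>y\<close>.\<close>

lemma coercive_Dirichlet:
  assumes T: "T \<ge> 1" and \<alpha>: "\<alpha> < 1 / (2 * c2 T)"
    and f: "\<And>k s. k \<in> {1..T} \<Longrightarrow> f k s \<ge> - \<alpha> * s\<^sup>2 + \<beta> * s + \<gamma> k"
  shows "\<exists>R. \<forall>x\<in>space_H T.
    (\<Sum>k=1..T+1. (fwd_diff x (k - 1))\<^sup>2 / 2) + (\<Sum>k=1..T. f k (x k)) \<le> C \<longrightarrow> (\<forall>k. \<bar>x k\<bar> \<le> R)"
proof -
  define d where "d = 1 / (2 * c2 T) - \<alpha>"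
  have d: "d > 0" using \<alpha> by (simp add: d_def)
  have c2: "c2 T > 0" using poincare_const_c2(1)[OF T] by (simp add: poincare_const_def)
  \<comment> \<open>Half of the margin \<open>d\<close> absorbs the linear term by completing the
    square, at the cost \<open>\<beta>\<^sup>2 / (2 * d)\<close> per index; the other half controls
    the sum of squares, and solving for it gives \<open>K\<close>.\<close>
  define K where "K = (C + (\<Sum>k=1..T. \<beta>\<^sup>2 / (2 * d) - \<gamma> k)) * (2 / d)"
  have "\<bar>x k\<bar> \<le> sqrt K"
    if x: "x \<in> space_H T" and
      le: "(\<Sum>k=1..T+1. (fwd_diff x (k - 1))\<^sup>2 / 2) + (\<Sum>k=1..T. f k (x k)) \<le> C" for x k
  proof -
    have "(\<Sum>k=1..T. (x k)\<^sup>2) \<le> c2 T * (\<Sum>k=1..T+1. (fwd_diff x (k - 1))\<^sup>2)"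
      using poincare_const_c2(1)[OF T] x unfolding poincare_const_def power2_abs by blast
    then have "(\<Sum>k=1..T. 1 / (2 * c2 T) * (x k)\<^sup>2) \<le> (\<Sum>k=1..T+1. (fwd_diff x (k - 1))\<^sup>2 / 2)"
      using c2 by (simp add: field_simps flip: sum_distrib_left sum_divide_distrib)
    moreover have "(\<Sum>k=1..T. - \<alpha> * (x k)\<^sup>2 + \<beta> * x k + \<gamma> k) \<le> (\<Sum>k=1..T. f k (x k))"
      by (intro sum_mono f)
    ultimately have "(\<Sum>k=1..T. 1 / (2 * c2 T) * (x k)\<^sup>2 + (- \<alpha> * (x k)\<^sup>2 + \<beta> * x k + \<gamma> k)) \<le> C"
      using le unfolding sum.distrib by linarith
    moreover have "d / 2 * (x k)\<^sup>2 - (\<beta>\<^sup>2 / (2 * d) - \<gamma> k) \<le> 1 / (2 * c2 T) * (x k)\<^sup>2 + (- \<alpha> * (x k)\<^sup>2 + \<beta> * x k + \<gamma> k)" for k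
    proof -
      have "0 \<le> (d * x k + \<beta>)\<^sup>2 / (2 * d)" using d by simp
      also have "\<dots> = d / 2 * (x k)\<^sup>2 + \<beta> * x k + \<beta>\<^sup>2 / (2 * d)"
        using d by (simp add: power2_eq_square field_simps)
      finally have "0 \<le> d / 2 * (x k)\<^sup>2 + \<beta> * x k + \<beta>\<^sup>2 / (2 * d)" .
      moreover have "1 / (2 * c2 T) * (x k)\<^sup>2 = d * (x k)\<^sup>2 + \<alpha> * (x k)\<^sup>2"
        by (simp add: d_def algebra_simps)
      moreover have "d / 2 * (x k)\<^sup>2 + d / 2 * (x k)\<^sup>2 = d * (x k)\<^sup>2" by simp
      ultimately show ?thesis by linarith
    qed
    then have "(\<Sum>k=1..T. d / 2 * (x k)\<^sup>2 - (\<beta>\<^sup>2 / (2 * d) - \<gamma> k))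
      \<le> (\<Sum>k=1..T. 1 / (2 * c2 T) * (x k)\<^sup>2 + (- \<alpha> * (x k)\<^sup>2 + \<beta> * x k + \<gamma> k))"
      by (rule sum_mono)
    ultimately have "(\<Sum>k=1..T. d / 2 * (x k)\<^sup>2 - (\<beta>\<^sup>2 / (2 * d) - \<gamma> k)) \<le> C"
      by linarith
    then have "d / 2 * (\<Sum>k=1..T. (x k)\<^sup>2) \<le> C + (\<Sum>k=1..T. \<beta>\<^sup>2 / (2 * d) - \<gamma> k)"
      by (simp only: sum_subtractf flip: sum_distrib_left)
    then have S: "(\<Sum>k=1..T. (x k)\<^sup>2) \<le> K"
      using d unfolding K_def by (simp add: field_simps)
    have "(x k)\<^sup>2 \<le> (\<Sum>k=1..T. (x k)\<^sup>2)"
    proof (cases "k \<in> {1..T}")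
      case True
      then show ?thesis by (intro member_le_sum[of k _ "\<lambda>k. (x k)\<^sup>2"]) auto
    next
      case False
      then have "x k = 0" by (rule space_H_eq_0[OF x])
      then show ?thesis by (simp add: sum_nonneg)
    qed
    with S show ?thesis by (metis order_trans real_sqrt_abs real_sqrt_le_mono)
  qed
  then show ?thesis by blast
qed

section \<open>The Euler-Lagrange difference equation\<close>

text \<open>Fermat's rule in one coordinate: replacing \<open>x k\<close> by a real \<open>s\<close>
  stays in \<open>space_H T\<close> as \<open>k\<close> is an interior index, and the resulting
  function of \<open>s\<close> is minimal at \<open>x k\<close>.\<close>

lemma Euler_Lagrange_Dirichlet:
  assumes x: "x \<in> space_H T" and k: "k \<in> {1..T}"
    and f: "f k differentiable (at (x k))"
    and min: "\<And>z. z \<in> space_H T \<Longrightarrow>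
      (\<Sum>k=1..T+1. (fwd_diff x (k - 1))\<^sup>2 / 2) + (\<Sum>k=1..T. f k (x k))
      \<le> (\<Sum>k=1..T+1. (fwd_diff z (k - 1))\<^sup>2 / 2) + (\<Sum>k=1..T. f k (z k))"
  shows "fwd_diff (fwd_diff x) (k - 1) = deriv (f k) (x k)"
proof -
  define z where "z s = x(k := s)" for s
  define \<phi> where "\<phi> s = (\<Sum>j=1..T+1. (fwd_diff (z s) (j - 1))\<^sup>2 / 2) + (\<Sum>j=1..T. f j (z s j))" for s
  \<comment> \<open>\<open>c j\<close> is the derivative in \<open>s\<close> of the
    \<open>j\<close>-th difference \<open>z s j - z s (j - 1)\<close>: coordinate \<open>k\<close>
    enters for \<open>j = k\<close> and \<open>j = k + 1\<close> alone.\<close>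
  define c where "c j = (if j = k then 1 else if j = k + 1 then - 1 else 0 :: real)" for j
  have fk: "(f k has_real_derivative deriv (f k) (x k)) (at (x k))"
    using f by (simp add: DERIV_deriv_iff_real_differentiable)
  have zH: "z s \<in> space_H T" for s using x k by (auto simp: z_def space_H_def)
  have zx: "z (x k) = x" by (simp add: z_def)
  have df: "((\<lambda>s. fwd_diff (z s) (j - 1)) has_real_derivative c j) (at (x k))" if "j \<in> {1..T+1}" for j
  proof -
    consider "j = k" | "j = k + 1" | "j \<noteq> k" "j \<noteq> k + 1" by blast
    then show ?thesis
    proof cases
      case 1
      then have "(\<lambda>s. fwd_diff (z s) (j - 1)) = (\<lambda>s. s - x (k - 1))"
        using k by (auto simp: fwd_diff_def z_def fun_eq_iff)
      then show ?thesis using 1 by (auto simp: c_def intro!: derivative_eq_intros)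
    next
      case 2
      then have "(\<lambda>s. fwd_diff (z s) (j - 1)) = (\<lambda>s. x (k + 1) - s)"
        by (auto simp: fwd_diff_def z_def)
      then show ?thesis using 2 by (auto simp: c_def intro!: derivative_eq_intros)
    next
      case 3
      then have "(\<lambda>s. fwd_diff (z s) (j - 1)) = (\<lambda>s. fwd_diff x (j - 1))"
        using that by (auto simp: fwd_diff_def z_def fun_eq_iff)
      then show ?thesis using 3 by (auto simp: c_def)
    qed
  qed
  have dQ: "((\<lambda>s. (fwd_diff (z s) (j - 1))\<^sup>2 / 2) has_real_derivative fwd_diff x (j - 1) * c j) (at (x k))"
    if "j \<in> {1..T+1}" for j
    using DERIV_cdivide[OF DERIV_power[OF df[OF that], of 2], of 2] by (simp add: zx mult.commute)
  have dF: "((\<lambda>s. f j (z s j)) has_real_derivative (if j = k then deriv (f k) (x k) else 0)) (at (x k))" for j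
    using fk by (auto simp: z_def)
  have "(\<phi> has_real_derivative
      (\<Sum>j=1..T+1. fwd_diff x (j - 1) * c j) + (\<Sum>j=1..T. if j = k then deriv (f k) (x k) else 0)) (at (x k))"
    unfolding \<phi>_def by (intro DERIV_add DERIV_sum dF dQ)
  moreover have "\<forall>s. \<bar>x k - s\<bar> < 1 \<longrightarrow> \<phi> (x k) \<le> \<phi> s"
    using min[OF zH] by (simp add: \<phi>_def zx)
  ultimately have "(\<Sum>j=1..T+1. fwd_diff x (j - 1) * c j) + (\<Sum>j=1..T. if j = k then deriv (f k) (x k) else 0) = 0"
    by (rule DERIV_local_min[OF _ zero_less_one])
  \<comment> \<open>The difference sum runs up to \<open>T + 1\<close>, so both \<open>k\<close> and
    \<open>k + 1\<close> are in range, even for \<open>k = T\<close>.\<close>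
  moreover have "(\<Sum>j=1..T+1. fwd_diff x (j - 1) * c j) = fwd_diff x (k - 1) - fwd_diff x k"
  proof -
    have "(\<Sum>j=1..T+1. fwd_diff x (j - 1) * c j)
      = (\<Sum>j=1..T+1. (if j = k then fwd_diff x (k - 1) else 0) - (if j = k + 1 then fwd_diff x k else 0))"
      by (intro sum.cong) (auto simp: c_def)
    also have "\<dots> = fwd_diff x (k - 1) - fwd_diff x k"
      using k by (simp only: sum_subtractf sum.delta finite_atLeastAtMost) auto
    finally show ?thesis .
  qed
  moreover have "(\<Sum>j=1..T. if j = k then deriv (f k) (x k) else 0) = deriv (f k) (x k)"
    using k by (simp add: sum.delta)
  ultimately show ?thesis
    using k by (simp add: fwd_diff_def[of "fwd_diff x"])
qed

section \<open>The action functional and its saddle point\<close>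

lemma action_J_split:
  "action_J F T u x y = (\<Sum>k=1..T+1. (fwd_diff x (k - 1))\<^sup>2 / 2) - (\<Sum>k=1..T+1. (fwd_diff y (k - 1))\<^sup>2 / 2)
    + (\<Sum>k=1..T. F k (x k) (y k) (u k))"
  by (simp add: action_J_def sum_subtractf)

lemma continuous_on_action_J:
  assumes "continuous_on ({1..T} \<times> UNIV) (\<lambda>(k, x, y, v). F k x y v)"
  shows "continuous_on S (\<lambda>(x, y). action_J F T u x y)"
proof -
  have c: "continuous_on S (\<lambda>p. fst p k)" "continuous_on S (\<lambda>p. snd p k)"
    for S :: "((nat \<Rightarrow> real) \<times> (nat \<Rightarrow> real)) set" and k
    by (rule continuous_on_product_then_coordinatewise,
        intro continuous_on_fst continuous_on_snd continuous_on_id)+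
  have "continuous_on S (\<lambda>p. F k (fst p k) (snd p k) (u k))" if "k \<in> {1..T}" for k
    using that by (intro continuous_on_compose2[OF assms, of S "\<lambda>p. (k, fst p k, snd p k, u k)", simplified])
      (auto intro!: continuous_intros c)
  then show ?thesis
    unfolding case_prod_beta action_J_split fwd_diff_def by (intro continuous_intros c) auto
qed

theorem theorem4:
  fixes T :: nat and D :: real
    and F :: "nat \<Rightarrow> real \<Rightarrow> real \<Rightarrow> real \<Rightarrow> real"
    and u :: "nat \<Rightarrow> real"
  assumes T: "T \<ge> 2" and D: "D > 0"
    and F_cont: "continuous_on ({1..T} \<times> UNIV) (\<lambda>(k, x, y, v). F k x y v)"
    and F_diff_x: "\<And>k x y v. k \<in> {1..T} \<Longrightarrow> (\<lambda>s. F k s y v) differentiable (at x)"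
    and F_diff_y: "\<And>k x y v. k \<in> {1..T} \<Longrightarrow> (\<lambda>s. F k x s v) differentiable (at y)"
    and Fx_cont: "continuous_on ({1..T} \<times> UNIV) (\<lambda>(k, x, y, v). partial_x F k x y v)"
    and Fy_cont: "continuous_on ({1..T} \<times> UNIV) (\<lambda>(k, x, y, v). partial_y F k x y v)"
    and lower: "\<And>y. y \<in> space_H T \<Longrightarrow>
      \<exists>(\<beta>1::real) (\<gamma>1::nat \<Rightarrow> real) (\<alpha>1::real). \<alpha>1 < 1 / (2 * c2 T) \<and>
        (\<forall>x v. \<forall>k\<in>{1..T}. \<bar>v\<bar> \<le> D \<longrightarrow>
          F k x (y k) v \<ge> - \<alpha>1 * \<bar>x\<bar>^2 + \<beta>1 * x + \<gamma>1 k)"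
    and upper: "\<And>x. x \<in> space_H T \<Longrightarrow>
      \<exists>(\<beta>2::real) (\<gamma>2::nat \<Rightarrow> real) (\<alpha>2::real). \<alpha>2 < 1 / (2 * c2 T) \<and>
        (\<forall>y v. \<forall>k\<in>{1..T}. \<bar>v\<bar> \<le> D \<longrightarrow>
          F k (x k) y v \<le> \<alpha>2 * \<bar>y\<bar>^2 + \<beta>2 * y + \<gamma>2 k)"
    and J_convex: "\<And>y v. y \<in> space_H T \<Longrightarrow> v \<in> space_L T D \<Longrightarrow>
      convex_on (space_H T) (\<lambda>x. action_J F T v x y)"
    and J_concave: "\<And>x v. x \<in> space_H T \<Longrightarrow> v \<in> space_L T D \<Longrightarrow>
      concave_on (space_H T) (\<lambda>y. action_J F T v x y)"
    and u: "u \<in> space_L T D"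
  shows "\<exists>xu\<in>space_H T. \<exists>yu\<in>space_H T.
    saddle_point (action_J F T u) (space_H T) (space_H T) xu yu \<and>
    (\<forall>k\<in>{1..T}.
      fwd_diff (fwd_diff xu) (k - 1) = partial_x F k (xu k) (yu k) (u k) \<and>
      fwd_diff (fwd_diff yu) (k - 1) = - partial_y F k (xu k) (yu k) (u k)) \<and>
    xu 0 = 0 \<and> xu (T + 1) = 0 \<and> yu 0 = 0 \<and> yu (T + 1) = 0"
proof -
  let ?H = "space_H T" and ?J = "action_J F T u"
  have u_bound: "\<bar>u k\<bar> \<le> D" if "k \<in> {1..T}" for k
    using u that unfolding space_L_def by (auto intro: order_trans[OF Max_ge])
  have "\<exists>x0 y0. saddle_point ?J ?H ?H x0 y0"
  proof (rule saddle_point_coercive)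
    show "continuous_on (?H \<times> ?H) (\<lambda>(x, y). ?J x y)"
      using F_cont by (rule continuous_on_action_J)
    show "convex_on ?H (\<lambda>x. ?J x y)" if "y \<in> ?H" for y
      using J_convex[OF that u] .
    show "concave_on ?H (\<lambda>y. ?J x y)" if "x \<in> ?H" for x
      using J_concave[OF that u] .
    show "\<exists>R. \<forall>x\<in>?H. ?J x 0 \<le> C \<longrightarrow> (\<forall>k. \<bar>x k\<bar> \<le> R)" for C
    proof -
      \<comment> \<open>At \<open>y = 0\<close> the \<open>y\<close>-difference term vanishes and
        \<open>?J x 0\<close> has the form treated by \<open>coercive_Dirichlet\<close>;
        \<open>v = u k\<close> is admissible by \<open>u_bound\<close>.\<close>
      obtain \<beta> \<gamma> \<alpha> where \<alpha>: "\<alpha> < 1 / (2 * c2 T)"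
        and lo: "\<And>x v k. \<lbrakk>k \<in> {1..T}; \<bar>v\<bar> \<le> D\<rbrakk> \<Longrightarrow> F k x 0 v \<ge> - \<alpha> * x\<^sup>2 + \<beta> * x + \<gamma> k"
        using lower[OF zero_in_space_H] unfolding zero_fun_def power2_abs by blast
      show ?thesis
        using coercive_Dirichlet[OF _ \<alpha>, where f = "\<lambda>k s. F k s 0 (u k)" and \<beta> = \<beta> and \<gamma> = \<gamma> and C = C] T lo u_bound
        by (simp add: action_J_split fwd_diff_def)
    qed
    show "\<exists>R. \<forall>y\<in>?H. ?J 0 y \<ge> C \<longrightarrow> (\<forall>k. \<bar>y k\<bar> \<le> R)" for C
    proof -
      obtain \<beta> \<gamma> \<alpha> where \<alpha>: "\<alpha> < 1 / (2 * c2 T)"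
        and up: "\<And>y v k. \<lbrakk>k \<in> {1..T}; \<bar>v\<bar> \<le> D\<rbrakk> \<Longrightarrow> F k 0 y v \<le> \<alpha> * y\<^sup>2 + \<beta> * y + \<gamma> k"
        using upper[OF zero_in_space_H] unfolding zero_fun_def power2_abs by blast
      \<comment> \<open>Reflection: \<open>- ?J 0 y\<close> is again a difference term plus a
        potential, now \<open>- F\<close>, and the superlevel set at \<open>C\<close> becomes the
        sublevel set at \<open>- C\<close>.\<close>
      have "- F k 0 s (u k) \<ge> - \<alpha> * s\<^sup>2 + (- \<beta>) * s + (- \<gamma> k)" if "k \<in> {1..T}" for k s
        using up[OF that u_bound[OF that], of s] by simp
      from coercive_Dirichlet[OF _ \<alpha> this, where C = "- C"] T show ?thesis
        by (simp add: action_J_split fwd_diff_def sum_negf algebra_simps)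
    qed
  qed
  then obtain x y where xy: "saddle_point ?J ?H ?H x y" by blast
  then have x: "x \<in> ?H" and y: "y \<in> ?H"
    and min: "\<And>z. z \<in> ?H \<Longrightarrow> ?J x y \<le> ?J z y" and max: "\<And>z. z \<in> ?H \<Longrightarrow> ?J x z \<le> ?J x y"
    by (auto simp: saddle_point_def)
  \<comment> \<open>With \<open>y\<close> frozen, its difference term is a constant that cancels
    from the minimality inequality, so \<open>x\<close> minimizes a functional of one
    variable.\<close>
  have "fwd_diff (fwd_diff x) (k - 1) = partial_x F k (x k) (y k) (u k)" if k: "k \<in> {1..T}" for k
    unfolding partial_x_def
  proof (rule Euler_Lagrange_Dirichlet[OF x k, of "\<lambda>k s. F k s (y k) (u k)"])
    show "(\<lambda>s. F k s (y k) (u k)) differentiable at (x k)" by (rule F_diff_x[OF k])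
  qed (use min in \<open>unfold action_J_split, force\<close>)
  moreover have "fwd_diff (fwd_diff y) (k - 1) = - partial_y F k (x k) (y k) (u k)" if k: "k \<in> {1..T}" for k
  proof -
    \<comment> \<open>As a maximizer of \<open>?J x\<close>, \<open>y\<close> minimizes the
      functional with potential \<open>- F\<close>, whence the minus sign in the second
      equation.\<close>
    have "fwd_diff (fwd_diff y) (k - 1) = deriv (\<lambda>s. - F k (x k) s (u k)) (y k)"
    proof (rule Euler_Lagrange_Dirichlet[OF y k, of "\<lambda>k s. - F k (x k) s (u k)"])
      show "(\<lambda>s. - F k (x k) s (u k)) differentiable at (y k)"
        by (intro differentiable_minus F_diff_y[OF k])
    qed (use max in \<open>unfold action_J_split sum_negf, force\<close>)
    also have "\<dots> = - partial_y F k (x k) (y k) (u k)"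
      using F_diff_y[OF k, of "x k" "u k" "y k"] unfolding partial_y_def
      by (intro DERIV_imp_deriv DERIV_minus) (simp add: DERIV_deriv_iff_real_differentiable)
    finally show ?thesis .
  qed
  ultimately show ?thesis
    using xy x y by (intro bexI[of _ x] bexI[of _ y]) (auto simp: space_H_def)
qed

end
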